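(* Let $K\subset\mathbb{R}^d$ be a QCO set, $\sigma>0$, $N\ge1$ and $\epsilon\in[0,c_0)$ with $c_0<1/2$. Let $k_1^\star,k_2^\star$ be the first and second optimal dimensions (for testing) and $k_e^\star$ the optimal dimension in estimation. Then $$\sigma^2\max\left\{\frac{\sqrt{k_1^\star}}{N},\ \epsilon\sqrt{\frac{k_2^\star}{N}},\ \epsilon^2\right\}\ \lesssim\ \sigma^2\max\left\{\frac{k_e^\star}{N},\ \epsilon^2\right\},$$ where $\lesssim$ hides a universal constant.
   Context: QCO set: $K\subset\mathbb{R}^d$ is quadratically convex orthosymmetric if (1) $K$ is convex; (2) $K^2:=\{(\theta_1^2,\dots,\theta_d^2)^\top:\theta\in K\}$ is convex; (3) $\theta\in K$ implies $(\eta_1\theta_1,\dots,\eta_d\theta_d)^\top\in K$ for all $\eta_i\in\{-1,1\}$. Kolmogorov $k$-width: $D_k(K)=\inf_{P\in\mathcal P_k}\sup_{\theta\in K}\|\theta-P\theta\|_2$, $\mathcal P_k$ being the set of orthogonal projections of rank $k$ in $\mathbb{R}^d$; $D_k(K)=\infty$ for $k<0$, $D_k(K)=0$ for $k>d$. Optimal dimensions: $k_1^\star=\max\{j:0\le j\le d,\ D_{j-1}(K)>\frac{j^{1/4}}{\sqrt N}\sigma\}$; $k_2^\star=\max\{j:0\le j\le d,\ D_{j-1}(K)>\frac{j^{1/4}\sqrt\epsilon}{N^{1/4}}\sigma\}$; $k_e^\star$ is the integer with $D_{k_e^\star-1}(K)>\sqrt{k_e^\star/N}\,\sigma$ and $D_{k_e^\star}(K)\le\sqrt{(k_e^\star+1)/N}\,\sigma$,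 i.e. $k_e^\star=\max\{k:0\le k\le d,\ D_{k-1}(K)>\sqrt{k/N}\,\sigma\}$. Standing assumption of the paper: $D_0(K)=\sup_{\theta\in K}\|\theta\|_2>\sigma/\sqrt N$, i.e. $k_1^\star\ge1$. *)

theory Defs
  imports Complex_Main "HOL-Library.Extended_Real" "Jordan_Normal_Form.DL_Rank"
begin

text \<open>The dimension \<open>d\<close> is a term-level natural number, and \<open>\<real>\<^sup>d\<close> is \<open>carrier_vec d\<close>,
  so that a constant can be chosen uniformly in the dimension.\<close>

definition vec_norm2 :: "real vec \<Rightarrow> real" where
  "vec_norm2 v = sqrt (v \<bullet> v)"

definition convex_vec_set :: "real vec set \<Rightarrow> bool" where
  "convex_vec_set S \<longleftrightarrow>
     (\<forall>x\<in>S. \<forall>y\<in>S. \<forall>t. 0 \<le> t \<and> t \<le> 1 \<longrightarrow> (1 - t) \<cdot>\<^sub>v x + t \<cdot>\<^sub>v y \<in> S)"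

definition coordinate_squares :: "real vec set \<Rightarrow> real vec set" where
  "coordinate_squares K = map_vec (\<lambda>x. x\<^sup>2) ` K"

definition QCO :: "nat \<Rightarrow> real vec set \<Rightarrow> bool" where
  "QCO d K \<longleftrightarrow>
     K \<subseteq> carrier_vec d \<and>
     convex_vec_set K \<and>
     convex_vec_set (coordinate_squares K) \<and>
     (\<forall>\<theta>\<in>K. \<forall>\<eta>::nat \<Rightarrow> real. (\<forall>i<d. \<eta> i \<in> {-1, 1}) \<longrightarrow> vec d (\<lambda>i. \<eta> i * \<theta> $ i) \<in> K)"

definition orthogonal_projections :: "nat \<Rightarrow> nat \<Rightarrow> real mat set" where
  "orthogonal_projections d k =
     {P \<in> carrier_mat d d. P * P = P \<and> transpose_mat P = P \<and> vec_space.rank d P = k}"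

text \<open>The width is extended-real valued because \<open>K\<close> may be unbounded and because of the
  convention at negative \<open>k\<close>. The supremum over an empty \<open>K\<close> is \<open>-\<infinity>\<close> here.\<close>

definition kolmogorov_width :: "nat \<Rightarrow> real vec set \<Rightarrow> int \<Rightarrow> ereal" where
  "kolmogorov_width d K k =
     (if k < 0 then \<infinity>
      else if k > int d then 0
      else (INF P\<in>orthogonal_projections d (nat k).
              SUP \<theta>\<in>K. ereal (vec_norm2 (\<theta> - P *\<^sub>v \<theta>))))"

text \<open>The sets below always contain 0, since the width at \<open>-1\<close> is \<open>\<infinity>\<close>.\<close>

definition k1_star :: "nat \<Rightarrow> real vec set \<Rightarrow> real \<Rightarrow> nat \<Rightarrow> nat" where
  "k1_star d K \<sigma> N =
     Max {j. j \<le> d \<and>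
       kolmogorov_width d K (int j - 1) > ereal (real j powr (1/4) / sqrt (real N) * \<sigma>)}"

definition k2_star :: "nat \<Rightarrow> real vec set \<Rightarrow> real \<Rightarrow> nat \<Rightarrow> real \<Rightarrow> nat" where
  "k2_star d K \<sigma> N \<epsilon> =
     Max {j. j \<le> d \<and>
       kolmogorov_width d K (int j - 1) >
         ereal (real j powr (1/4) * sqrt \<epsilon> / real N powr (1/4) * \<sigma>)}"

definition ke_star :: "nat \<Rightarrow> real vec set \<Rightarrow> real \<Rightarrow> nat \<Rightarrow> nat" where
  "ke_star d K \<sigma> N =
     Max {k. k \<le> d \<and>
       kolmogorov_width d K (int k - 1) > ereal (sqrt (real k / real N) * \<sigma>)}"

end

theory Submission
  imports Defs
begin

text \<open>Write \<open>e\<close> for \<open>ke_star\<close> and let \<open>k\<close> be one of the testing dimensions. If \<open>k \<le> e\<close> the bound is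
  elementary (\<open>sqrt k \<le> k\<close>, respectively AM-GM). Otherwise \<open>e < d\<close>, so maximality of \<open>e\<close> together
  with monotonicity of the widths compares the thresholds: the one for \<open>k\<close> is below
  \<open>D\<^bsub>k-1\<^esub> \<le> D\<^bsub>e\<^esub> \<le> sqrt ((e + 1) / N) \<sigma>\<close>. Squaring and using \<open>e \<ge> 1\<close> gives the claim with
  constant 2. Monotonicity of the widths holds because adding to a projection the projection onto
  a line of its kernel raises the rank by one and does not increase any residual.\<close>

section \<open>Rank growth when a direction is added to a column space\<close>

lemma (in vec_space) span_maximal_lin_indpt:
  assumes A: "A \<subseteq> carrier_vec n"
    and S: "maximal S (\<lambda>T. T \<subseteq> A \<and> lin_indpt T)"
  shows "span S = span A"
proof
  have SA: "S \<subseteq> A" and li: "lin_indpt S"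
    using S unfolding maximal_def by auto
  then show "span S \<subseteq> span A"
    using span_is_monotone by blast
  have "a \<in> span S" if "a \<in> A" for a
  proof (cases "a \<in> S")
    case True
    then show ?thesis
      using A SA in_own_span[of S] by auto
  next
    case False
    then have "\<not> lin_indpt (S \<union> {a})"
      using S SA that unfolding maximal_def by blast
    then show ?thesis
      using lin_dep_iff_in_span[of S a] A SA li False that by auto
  qed
  then show "span A \<subseteq> span S"
    using span_subsetI[of S A] A SA by blast
qed

text \<open>A maximal independent set \<open>S\<close> of columns of \<open>P\<close>, together with
  \<open>u\<close>, is a basis of the column space of \<open>Q\<close>: it is independent since
  \<open>u\<close> avoids the span of \<open>S\<close>, \<open>Q\<close> fixes its elements, and the
  formula for \<open>col Q i\<close> puts every column of \<open>Q\<close> in its span.\<close>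

lemma (in vec_space) rank_plus_kernel_direction:
  assumes P: "P \<in> carrier_mat n n" and Q: "Q \<in> carrier_mat n n"
    and u: "u \<in> carrier_vec n" and u0: "u \<notin> span (set (cols P))"
    and Qu: "Q *\<^sub>v u = u"
    and QP: "\<And>i. i < n \<Longrightarrow> Q *\<^sub>v col P i = col P i"
    and col: "\<And>i. i < n \<Longrightarrow> col Q i = col P i + c i \<cdot>\<^sub>v u"
  shows "rank Q = Suc (rank P)"
proof -
  have cP: "set (cols P) \<subseteq> carrier_vec n" and cQ: "set (cols Q) \<subseteq> carrier_vec n"
    using P Q cols_dim by blast+
  have fixpt: "x \<in> span (set (cols Q))" if "x \<in> carrier_vec n" "Q *\<^sub>v x = x" for x
    using col_space_eq[OF Q] that Q unfolding col_space_def by auto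
  obtain S where S: "maximal S (\<lambda>T. T \<subseteq> set (cols P) \<and> lin_indpt T)"
    using maximal_exists_superset[of "set (cols P)" "\<lambda>T. T \<subseteq> set (cols P) \<and> lin_indpt T" "{}"]
    by (metis (no_types, lifting) List.finite_set empty_iff empty_subsetI finite.emptyI finite_lin_indpt2)
  then have SP: "S \<subseteq> set (cols P)" and li: "lin_indpt S"
    unfolding maximal_def by auto
  then have SC: "S \<subseteq> carrier_vec n" and fS: "finite S"
    using cP finite_subset by blast+
  have spS: "span S = span (set (cols P))"
    by (rule span_maximal_lin_indpt[OF cP S])
  define U where "U = S \<union> {u}"
  have uS: "u \<notin> S"
    using u0 spS SC in_own_span[of S] by auto
  have liU: "lin_indpt U"
    using lin_dep_iff_in_span[of S u] SC li u uS u0 spS unfolding U_def by auto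
  have UC: "U \<subseteq> carrier_vec n" and fU: "finite U"
    using SC u fS unfolding U_def by auto
  have "x \<in> span (set (cols Q))" if "x \<in> U" for x
  proof -
    have "Q *\<^sub>v x = x"
      using that SP QP Qu P unfolding U_def cols_def by auto
    then show ?thesis
      using fixpt that UC by blast
  qed
  then have sub1: "span U \<subseteq> span (set (cols Q))"
    using span_subsetI[OF cQ] by blast
  have "x \<in> span U" if x: "x \<in> set (cols Q)" for x
  proof -
    obtain i where i: "i < n" "x = col Q i"
      using x Q by (auto simp: cols_def)
    have "col P i \<in> span (set (cols P))"
      using i P cP in_own_span[of "set (cols P)"] by (auto simp: cols_def)
    then have "col P i \<in> span U"
      using spS span_is_monotone[of S U] unfolding U_def by auto
    moreover have "c i \<cdot>\<^sub>v u \<in> span U"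
      using smult_in_span[OF UC, of u "c i"] in_own_span[of U] UC unfolding U_def by auto
    ultimately show ?thesis
      using span_add1[OF UC] col i by simp
  qed
  then have sub2: "span (set (cols Q)) \<subseteq> span U"
    using span_subsetI[OF UC] by blast
  \<comment> \<open>An independent set is trivially maximal among its own independent subsets, which
    is the form \<open>dim_span\<close> asks for.\<close>
  have "maximal U (\<lambda>T. T \<subseteq> U \<and> lin_indpt T)"
    using liU unfolding maximal_def by auto
  then have "vectorspace.dim class_ring (span_vs U) = card U"
    using dim_span[of U U] UC fU by simp
  then have "rank Q = card U"
    unfolding rank_def using sub1 sub2 by (simp add: subset_antisym)
  also have "\<dots> = Suc (rank P)"
    using rank_card_indpt[OF P S] fS uS unfolding U_def by simp
  finally show ?thesis .
qed

section \<open>Extending an orthogonal projection by one dimension\<close>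

lemma col_eq_mult_unit_vec:
  fixes A :: "'a :: semiring_1 mat"
  assumes "A \<in> carrier_mat nr nc" "j < nc"
  shows "col A j = A *\<^sub>v unit_vec nc j"
  using assms by (intro eq_vecI) auto

lemma real_scalar_prod_self_pos:
  fixes v :: "real vec"
  assumes "v \<in> carrier_vec n" "v \<noteq> 0\<^sub>v n"
  shows "v \<bullet> v > 0"
proof -
  obtain i where i: "i < n" "v $ i \<noteq> 0"
    using assms by (metis carrier_vecD eq_vecI index_zero_vec)
  then show ?thesis
    using assms(1) unfolding scalar_prod_def
    by (intro sum_pos2[of _ i]) (auto simp flip: power2_eq_square)
qed

lemma singular_unit_kernel_vector:
  fixes P :: "real mat"
  assumes P: "P \<in> carrier_mat d d" and r: "vec_space.rank d P < d"
  obtains u where "u \<in> carrier_vec d" "P *\<^sub>v u = 0\<^sub>v d" "u \<bullet> u = 1"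
proof -
  interpret vec_space "TYPE(real)" d .
  obtain v where v: "v \<in> carrier_vec d" "v \<noteq> 0\<^sub>v d" "P *\<^sub>v v = 0\<^sub>v d"
    using det_rank_iff[OF P] r det_0_iff_vec_prod_zero_field[OF P] by auto
  have pos: "v \<bullet> v > 0"
    using real_scalar_prod_self_pos v by blast
  define u where "u = (1 / sqrt (v \<bullet> v)) \<cdot>\<^sub>v v"
  have "u \<in> carrier_vec d"
    using v unfolding u_def by simp
  moreover have "P *\<^sub>v u = 0\<^sub>v d"
    using v P unfolding u_def by (simp add: mult_mat_vec)
  moreover have "u \<bullet> u = 1"
    using v(1) pos unfolding u_def by (simp add: field_simps)
  ultimately show thesis
    using that by blast
qed

text \<open>Take a unit vector \<open>u\<close> in the kernel of \<open>P\<close> and add the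
  rank-one projection \<open>R\<close> onto its line. As \<open>P\<close> is symmetric,
  \<open>u\<close> is orthogonal to the range of \<open>P\<close>, so the sum is again an orthogonal
  projection, and each residual merely loses its component along \<open>u\<close>.\<close>

lemma orthogonal_projection_extend:
  assumes PP: "P \<in> orthogonal_projections d k" and kd: "k < d"
  obtains Q where "Q \<in> orthogonal_projections d (Suc k)"
    "\<And>x. x \<in> carrier_vec d \<Longrightarrow> vec_norm2 (x - Q *\<^sub>v x) \<le> vec_norm2 (x - P *\<^sub>v x)"
proof -
  interpret vec_space "TYPE(real)" d .
  have P: "P \<in> carrier_mat d d" and idem: "P * P = P" and sym: "transpose_mat P = P"
    and rk: "vec_space.rank d P = k"
    using PP unfolding orthogonal_projections_def by auto
  obtain u where u: "u \<in> carrier_vec d" and Pu: "P *\<^sub>v u = 0\<^sub>v d" and uu: "u \<bullet> u = 1"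
    using singular_unit_kernel_vector P rk kd by blast
  define R where "R = mat d d (\<lambda>(i,j). u $ i * u $ j)"
  define Q where "Q = P + R"
  have R: "R \<in> carrier_mat d d" and Q: "Q \<in> carrier_mat d d"
    using P unfolding R_def Q_def by auto
  have Rv: "R *\<^sub>v x = (u \<bullet> x) \<cdot>\<^sub>v u" if "x \<in> carrier_vec d" for x
    using that u unfolding R_def
    by (intro eq_vecI) (auto simp: scalar_prod_def sum_distrib_left mult_ac)
  have Qv: "Q *\<^sub>v x = P *\<^sub>v x + (u \<bullet> x) \<cdot>\<^sub>v u" if "x \<in> carrier_vec d" for x
    using that P R Rv unfolding Q_def by (simp add: add_mult_distrib_mat_vec)
  \<comment> \<open>Symmetry moves \<open>P\<close> onto \<open>u\<close>, where it
    vanishes.\<close>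
  have uP: "u \<bullet> (P *\<^sub>v x) = 0" if x: "x \<in> carrier_vec d" for x
  proof -
    have "u \<bullet> (P *\<^sub>v x) = (transpose_mat P *\<^sub>v u) \<bullet> x"
      using transpose_vec_mult_scalar[OF P x u] by simp
    then show ?thesis
      using sym Pu x by simp
  qed
  have PPv: "P *\<^sub>v (P *\<^sub>v x) = P *\<^sub>v x" if "x \<in> carrier_vec d" for x
    using assoc_mult_mat_vec[OF P P that] idem by simp
  have QQv: "Q *\<^sub>v (Q *\<^sub>v x) = Q *\<^sub>v x" if x: "x \<in> carrier_vec d" for x
  proof -
    have c: "P *\<^sub>v x \<in> carrier_vec d" "(u \<bullet> x) \<cdot>\<^sub>v u \<in> carrier_vec d"
      using P u x by auto
    have "P *\<^sub>v (Q *\<^sub>v x) = P *\<^sub>v x"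
      using c P PPv[OF x] Pu u by (simp add: Qv[OF x] mult_add_distrib_mat_vec[OF P] mult_mat_vec[OF P])
    moreover have "u \<bullet> (Q *\<^sub>v x) = u \<bullet> x"
      using c u uP[OF x] uu by (simp add: Qv[OF x] scalar_prod_add_distrib[OF u])
    moreover have "Q *\<^sub>v x \<in> carrier_vec d"
      using Q x by simp
    ultimately show ?thesis
      using Qv x by metis
  qed
  have "Q * Q = Q"
  proof (rule mat_col_eqI)
    fix j assume "j < dim_col Q"
    then have j: "j < d" using Q by simp
    have cj: "col Q j = Q *\<^sub>v unit_vec d j"
      using col_eq_mult_unit_vec[OF Q j] .
    have "col (Q * Q) j = Q *\<^sub>v col Q j"
      using col_mult2[OF Q Q j] .
    then show "col (Q * Q) j = col Q j"
      using cj QQv by simp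
  qed (use Q in auto)
  moreover have "transpose_mat Q = Q"
    using P R sym unfolding Q_def
    by (auto simp: transpose_add R_def intro!: eq_matI)
  moreover have "vec_space.rank d Q = Suc (vec_space.rank d P)"
  proof (rule rank_plus_kernel_direction[OF P Q u, where c = "\<lambda>i. u $ i"])
    show "u \<notin> span (set (cols P))"
    proof
      assume "u \<in> span (set (cols P))"
      \<comment> \<open>In the range of \<open>P\<close>, \<open>u\<close> would be orthogonal to
        itself, against \<open>u \<bullet> u = 1\<close>.\<close>
      then obtain x where x: "x \<in> carrier_vec d" "P *\<^sub>v x = u"
        using col_space_eq[OF P] P unfolding col_space_def by auto
      then show False
        using uP[OF x(1)] uu by simp
    qed
    show "Q *\<^sub>v u = u"
      using Qv[OF u] Pu uu u by simp
    fix i assume i: "i < d"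
    have ci: "col P i = P *\<^sub>v unit_vec d i"
      using col_eq_mult_unit_vec[OF P i] .
    show "Q *\<^sub>v col P i = col P i"
      using Qv[of "P *\<^sub>v unit_vec d i"] uP[of "unit_vec d i"] PPv[of "unit_vec d i"] P u
      unfolding ci by (intro eq_vecI) auto
    show "col Q i = col P i + u $ i \<cdot>\<^sub>v u"
      using P u i unfolding Q_def R_def by (intro eq_vecI) (auto simp: mult.commute)
  qed
  ultimately have "Q \<in> orthogonal_projections d (Suc k)"
    using Q rk unfolding orthogonal_projections_def by simp
  moreover have "vec_norm2 (x - Q *\<^sub>v x) \<le> vec_norm2 (x - P *\<^sub>v x)"
    if x: "x \<in> carrier_vec d" for x
  proof -
    define w where "w = x - P *\<^sub>v x"
    define c where "c = u \<bullet> x"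
    have w: "w \<in> carrier_vec d"
      using P x unfolding w_def by simp
    have uw: "u \<bullet> w = c"
      using uP[OF x] x P u unfolding w_def c_def by (simp add: scalar_prod_minus_distrib[OF u])
    have "x - Q *\<^sub>v x = w - c \<cdot>\<^sub>v u"
      using x P u unfolding w_def c_def Qv[OF x] by (intro eq_vecI) auto
    \<comment> \<open>Pythagoras: \<open>c\<close> is the coefficient of \<open>w\<close> along the
      unit vector \<open>u\<close>.\<close>
    then have "(x - Q *\<^sub>v x) \<bullet> (x - Q *\<^sub>v x) = w \<bullet> w - c\<^sup>2"
      using w u uw uu comm_scalar_prod[OF w u]
      by (simp add: minus_scalar_prod_distrib[where n = d] scalar_prod_minus_distrib[where n = d]
          power2_eq_square)
    then show ?thesis
      unfolding vec_norm2_def w_def[symmetric] by (simp add: real_sqrt_le_iff)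
  qed
  ultimately show thesis
    using that by blast
qed

section \<open>Monotonicity of the Kolmogorov widths\<close>

lemma kolmogorov_width_Suc_le:
  assumes K: "K \<subseteq> carrier_vec d" and kd: "k < d"
  shows "kolmogorov_width d K (int (Suc k)) \<le> kolmogorov_width d K (int k)"
proof -
  have "(INF P\<in>orthogonal_projections d (Suc k). SUP \<theta>\<in>K. ereal (vec_norm2 (\<theta> - P *\<^sub>v \<theta>)))
    \<le> (INF P\<in>orthogonal_projections d k. SUP \<theta>\<in>K. ereal (vec_norm2 (\<theta> - P *\<^sub>v \<theta>)))"
  proof (rule INF_mono)
    fix P assume "P \<in> orthogonal_projections d k"
    then obtain Q where Q: "Q \<in> orthogonal_projections d (Suc k)"
      "\<And>x. x \<in> carrier_vec d \<Longrightarrow> vec_norm2 (x - Q *\<^sub>v x) \<le> vec_norm2 (x - P *\<^sub>v x)"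
      using orthogonal_projection_extend kd by blast
    then show "\<exists>Q\<in>orthogonal_projections d (Suc k).
      (SUP \<theta>\<in>K. ereal (vec_norm2 (\<theta> - Q *\<^sub>v \<theta>))) \<le> (SUP \<theta>\<in>K. ereal (vec_norm2 (\<theta> - P *\<^sub>v \<theta>)))"
      using K by (intro bexI[OF _ Q(1)] SUP_mono) auto
  qed
  \<comment> \<open>Both \<open>k\<close> and \<open>Suc k\<close> are at most \<open>d\<close>, so
    both widths are given by the infimum branch of the definition.\<close>
  then show ?thesis
    using kd by (simp add: kolmogorov_width_def nat_add_distrib)
qed

lemma kolmogorov_width_antimono:
  assumes K: "K \<subseteq> carrier_vec d" and "k \<le> m" "m \<le> d"
  shows "kolmogorov_width d K (int m) \<le> kolmogorov_width d K (int k)"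
  using assms(2,3)
proof (induction m rule: dec_induct)
  case (step m)
  then show ?case
    using kolmogorov_width_Suc_le[OF K, of m] by force
qed simp

section \<open>Maximal indices at which the width exceeds a threshold\<close>

text \<open>The maximum is attained because the set is finite and contains 0. The threshold
  \<open>t\<close> is left arbitrary so that both testing dimensions are covered.\<close>

lemma Max_width_level_mem:
  fixes d :: nat and K :: "real vec set" and t :: "nat \<Rightarrow> real"
  defines "k \<equiv> Max {j. j \<le> d \<and> kolmogorov_width d K (int j - 1) > ereal (t j)}"
  shows "k \<le> d" "kolmogorov_width d K (int k - 1) > ereal (t k)"
proof -
  let ?A = "{j. j \<le> d \<and> kolmogorov_width d K (int j - 1) > ereal (t j)}"
  have "0 \<in> ?A"
    by (simp add: kolmogorov_width_def)
  then have "Max ?A \<in> ?A"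
    by (intro Max_in) auto
  then show "k \<le> d" "kolmogorov_width d K (int k - 1) > ereal (t k)"
    unfolding k_def by auto
qed

lemma Max_width_level_ge:
  fixes t :: "nat \<Rightarrow> real"
  assumes "j \<le> d" "kolmogorov_width d K (int j - 1) > ereal (t j)"
  shows "j \<le> Max {j. j \<le> d \<and> kolmogorov_width d K (int j - 1) > ereal (t j)}"
  using assms by (intro Max_ge) auto

lemma width_level_above_ke_star:
  assumes K: "K \<subseteq> carrier_vec d" and k: "k \<le> d" "ke_star d K \<sigma> N < k"
    and t: "kolmogorov_width d K (int k - 1) > ereal t"
  shows "t < sqrt (real (Suc (ke_star d K \<sigma> N)) / real N) * \<sigma>"
proof -
  define e where "e = ke_star d K \<sigma> N"
  \<comment> \<open>Here \<open>k\<close> is positive, so natural subtraction agrees with the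
    integer index.\<close>
  have "ereal t < kolmogorov_width d K (int (k - 1))"
    using t k(2) by (simp add: of_nat_diff)
  also have "\<dots> \<le> kolmogorov_width d K (int e)"
    using k unfolding e_def by (intro kolmogorov_width_antimono[OF K]) auto
  also have "\<dots> \<le> ereal (sqrt (real (Suc e) / real N) * \<sigma>)"
  \<comment> \<open>Otherwise \<open>Suc e\<close>, which is at most \<open>k\<close> and hence at
    most \<open>d\<close>, would lie in the set whose maximum is \<open>e\<close>; its level
    condition concerns the width at index \<open>e\<close>.\<close>
  proof (rule ccontr)
    assume "\<not> ?thesis"
    then have "Suc e \<le> ke_star d K \<sigma> N"
      unfolding ke_star_def using k e_def by (intro Max_width_level_ge) auto
    then show False
      unfolding e_def by simp
  qed
  finally show ?thesis
    unfolding e_def by simp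
qed

section \<open>Comparing the testing dimensions with the estimation dimension\<close>

lemma k1_star_bound:
  assumes K: "K \<subseteq> carrier_vec d" and s: "\<sigma> > 0" and N: "N \<ge> 1"
    and e: "ke_star d K \<sigma> N \<ge> 1"
  shows "sqrt (real (k1_star d K \<sigma> N)) / real N \<le> 2 * (real (ke_star d K \<sigma> N) / real N)"
proof -
  define e' k where "e' = ke_star d K \<sigma> N" and "k = k1_star d K \<sigma> N"
  have k: "k \<le> d" "kolmogorov_width d K (int k - 1) > ereal (real k powr (1/4) / sqrt (real N) * \<sigma>)"
    unfolding k_def k1_star_def by (rule Max_width_level_mem)+
  have "sqrt (real k) \<le> 2 * real e'"
  proof (cases "k \<le> e'")
    case True
    \<comment> \<open>Since \<open>e'\<close> is at least 1, \<open>k \<le> e'\<close> is bounded by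
      the square of \<open>e'\<close>.\<close>
    have "sqrt (real k) \<le> sqrt ((real e')\<^sup>2)"
      using True e e'_def
      by (intro real_sqrt_le_mono) (metis le_trans mult_le_mono mult_1 of_nat_le_iff of_nat_power power2_eq_square)
    then show ?thesis by simp
  next
    case False
    then have "real k powr (1/4) / sqrt (real N) * \<sigma> < sqrt (real (Suc e') / real N) * \<sigma>"
      using width_level_above_ke_star[OF K k(1) _ k(2)] unfolding e'_def by simp
    then have "real k powr (1/4) < sqrt (real (Suc e'))"
      using s N by (simp add: real_sqrt_divide field_simps)
    then have "(real k powr (1/4))\<^sup>2 \<le> (sqrt (real (Suc e')))\<^sup>2"
      by (intro power_mono) auto
    then have "sqrt (real k) \<le> real (Suc e')"
      by (simp add: power2_eq_square powr_half_sqrt flip: powr_add)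
    \<comment> \<open>The constant 2 arises here: \<open>Suc e' \<le> 2 * e'\<close> because
      \<open>e'\<close> is at least 1.\<close>
    then show ?thesis
      using e unfolding e'_def by simp
  qed
  then show ?thesis
    using N unfolding e'_def k_def by (simp add: field_simps)
qed

lemma k2_star_bound:
  assumes K: "K \<subseteq> carrier_vec d" and s: "\<sigma> > 0" and N: "N \<ge> 1" and eps: "0 \<le> \<epsilon>"
    and e: "ke_star d K \<sigma> N \<ge> 1"
  shows "\<epsilon> * sqrt (real (k2_star d K \<sigma> N \<epsilon>) / real N)
    \<le> 2 * max (real (ke_star d K \<sigma> N) / real N) (\<epsilon>\<^sup>2)"
proof -
  define e' k where "e' = ke_star d K \<sigma> N" and "k = k2_star d K \<sigma> N \<epsilon>"
  have k: "k \<le> d"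
    "kolmogorov_width d K (int k - 1) > ereal (real k powr (1/4) * sqrt \<epsilon> / real N powr (1/4) * \<sigma>)"
    unfolding k_def k2_star_def by (rule Max_width_level_mem)+
  show ?thesis
  proof (cases "k \<le> e'")
    case True
    \<comment> \<open>With this \<open>r\<close>, the product \<open>\<epsilon> * r\<close> is split
      by AM-GM into the two terms of the target maximum.\<close>
    define r where "r = sqrt (real e' / real N)"
    have "sqrt (real k / real N) \<le> r"
      using True unfolding r_def by (simp add: divide_right_mono)
    then have "\<epsilon> * sqrt (real k / real N) \<le> \<epsilon> * r"
      using eps by (simp add: mult_left_mono)
    also have "\<dots> \<le> r\<^sup>2 + \<epsilon>\<^sup>2"
    proof -
      have "0 \<le> \<epsilon> * r"
        using eps unfolding r_def by simp
      then show ?thesis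
        using sum_squares_bound[of r \<epsilon>] by (simp add: mult.commute)
    qed
    also have "\<dots> \<le> 2 * max (r\<^sup>2) (\<epsilon>\<^sup>2)"
      by simp
    also have "r\<^sup>2 = real e' / real N"
      unfolding r_def by simp
    finally show ?thesis
      unfolding e'_def k_def .
  next
    case False
    then have "real k powr (1/4) * sqrt \<epsilon> / real N powr (1/4) * \<sigma> < sqrt (real (Suc e') / real N) * \<sigma>"
      using width_level_above_ke_star[OF K k(1) _ k(2)] unfolding e'_def by simp
    then have "real k powr (1/4) * sqrt \<epsilon> / real N powr (1/4) < sqrt (real (Suc e') / real N)"
      using mult_less_cancel_right_pos[OF s] by blast
    \<comment> \<open>The square of the testing threshold without \<open>\<sigma>\<close> is exactly
      the quantity to bound, \<open>\<epsilon> * sqrt (k / N)\<close>.\<close>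
    then have "(real k powr (1/4) * sqrt \<epsilon> / real N powr (1/4))\<^sup>2 \<le> (sqrt (real (Suc e') / real N))\<^sup>2"
      using eps by (intro power_mono) auto
    moreover have "(x powr (1/4))\<^sup>2 = sqrt x" if "x \<ge> 0" for x :: real
      using that by (simp add: power2_eq_square powr_half_sqrt flip: powr_add)
    ultimately have "\<epsilon> * sqrt (real k / real N) \<le> real (Suc e') / real N"
      using eps by (simp add: power_mult_distrib power_divide real_sqrt_divide mult.commute)
    also have "\<dots> \<le> 2 * (real e' / real N)"
      using e N unfolding e'_def by (simp add: field_simps)
    finally show ?thesis
      unfolding e'_def k_def by linarith
  qed
qed

theorem lemma6p3:
  shows "\<exists>C::real. C > 0 \<and>
    (\<forall>(d::nat) (K::real vec set) (\<sigma>::real) (N::nat) (c\<^sub>0::real) (\<epsilon>::real).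
       QCO d K \<longrightarrow> \<sigma> > 0 \<longrightarrow> N \<ge> 1 \<longrightarrow> c\<^sub>0 < 1/2 \<longrightarrow> 0 \<le> \<epsilon> \<longrightarrow> \<epsilon> < c\<^sub>0 \<longrightarrow>
       kolmogorov_width d K 0 > ereal (\<sigma> / sqrt (real N)) \<longrightarrow>
       \<sigma>\<^sup>2 * max (sqrt (real (k1_star d K \<sigma> N)) / real N)
                (max (\<epsilon> * sqrt (real (k2_star d K \<sigma> N \<epsilon>) / real N)) (\<epsilon>\<^sup>2))
       \<le> C * (\<sigma>\<^sup>2 * max (real (ke_star d K \<sigma> N) / real N) (\<epsilon>\<^sup>2)))"
proof (intro exI[of _ 2] conjI allI impI)
  fix d K \<sigma> N and c\<^sub>0 \<epsilon> :: real
  assume "QCO d K" and s: "\<sigma> > 0" and N: "N \<ge> 1" and eps: "0 \<le> \<epsilon>"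
    and D0: "kolmogorov_width d K 0 > ereal (\<sigma> / sqrt (real N))"
  then have K: "K \<subseteq> carrier_vec d"
    unfolding QCO_def by blast
  let ?B = "max (real (ke_star d K \<sigma> N) / real N) (\<epsilon>\<^sup>2)"
  have "sqrt (real (k1_star d K \<sigma> N)) / real N \<le> 2 * ?B \<and>
    \<epsilon> * sqrt (real (k2_star d K \<sigma> N \<epsilon>) / real N) \<le> 2 * ?B"
  \<comment> \<open>For \<open>d = 0\<close> the index 1 is not admissible, but both testing
    dimensions are 0 and the left-hand sides vanish.\<close>
  proof (cases "d = 0")
    case True
    have "k1_star d K \<sigma> N \<le> d" "k2_star d K \<sigma> N \<epsilon> \<le> d"
      unfolding k1_star_def k2_star_def by (rule Max_width_level_mem(1))+
    with True show ?thesis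
      by (simp add: le_max_iff_disj)
  next
    case False
    \<comment> \<open>\<open>D0\<close> is the level condition of \<open>ke_star\<close> at index 1,
      which is admissible because \<open>d\<close> is positive.\<close>
    then have "ke_star d K \<sigma> N \<ge> 1"
      unfolding ke_star_def using D0
      by (intro Max_width_level_ge) (auto simp: real_sqrt_divide)
    then show ?thesis
      using k1_star_bound[OF K s N] k2_star_bound[OF K s N eps] by fastforce
  qed
  moreover have "\<epsilon>\<^sup>2 \<le> 2 * ?B"
    using zero_le_power2[of \<epsilon>] by linarith
  ultimately have "max (sqrt (real (k1_star d K \<sigma> N)) / real N)
      (max (\<epsilon> * sqrt (real (k2_star d K \<sigma> N \<epsilon>) / real N)) (\<epsilon>\<^sup>2)) \<le> 2 * ?B"
    by simp
  then show "\<sigma>\<^sup>2 * max (sqrt (real (k1_star d K \<sigma> N)) / real N)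
      (max (\<epsilon> * sqrt (real (k2_star d K \<sigma> N \<epsilon>) / real N)) (\<epsilon>\<^sup>2)) \<le> 2 * (\<sigma>\<^sup>2 * ?B)"
    using mult_left_mono[OF _ zero_le_power2[of \<sigma>]] by (simp only: mult.left_commute[of 2])
qed simp

end
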